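(* Let $\mathcal{T}$ be a triangulated category endowed with a pre-weight structure $(\mathcal{U}_{\geq0},\mathcal{U}_{\leq0})$ with core $\mathcal{C}$. Suppose that $\mathcal{T}$ is bi-complete and that the pre-weight structure $(\mathcal{U}_{\geq0},\mathcal{U}_{\leq0})$ is two-sided convergent. Assume that $\mathrm{Hom}_{\mathcal{T}}(\mathcal{C},\Sigma^{-n}(\mathcal{C}))=0$ for any $n\geq1$. Then we have $\mathrm{Hom}_{\mathcal{T}}(\mathcal{U}_{\leq0},\mathcal{U}_{\geq1})=0$.
   Context: Let $\Sigma$ be the suspension functor of $\mathcal{T}$. For full subcategories $\mathcal{X},\mathcal{Y}$, $\mathcal{X}\ast\mathcal{Y}$ is the full subcategory of objects $Z$ fitting into an exact triangle $X\to Z\to Y\to\Sigma(X)$ with $X\in\mathcal{X}$, $Y\in\mathcal{Y}$; $\mathcal{X}$ is closed under extensions if $\mathcal{X}\ast\mathcal{X}\subseteq\mathcal{X}$. A pre-weight structure on $\mathcal{T}$ is a pair $(\mathcal{U}_{\geq0},\mathcal{U}_{\leq0})$ of full additive subcategories such that (1) $\mathcal{U}_{\geq0}\ast\Sigma(\mathcal{U}_{\leq0})=\mathcal{T}$; (2) $\mathcal{U}_{\geq0}$ is closed under $\Sigma^{-1}$ and extensions; (3) $\mathcal{U}_{\leq0}$ is closed under $\Sigma$ and extensions. Its core is $\mathcal{C}=\mathcal{U}_{\geq0}\cap\mathcal{U}_{\leq0}$. Put $\mathcal{U}_{\geq m}=\Sigma^{-m}(\mathcal{U}_{\geq0})$,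 $\mathcal{U}_{\leq m}=\Sigma^{-m}(\mathcal{U}_{\leq0})$, $\mathcal{U}_{[m,n]}=\mathcal{U}_{\geq m}\cap\mathcal{U}_{\leq n}$ for $m\le n$. $\mathrm{Hom}_{\mathcal{T}}(\mathcal{X},\mathcal{Y})=0$ means $\mathrm{Hom}_{\mathcal{T}}(X,Y)=0$ for all $X\in\mathcal{X},Y\in\mathcal{Y}$. A left tower of $X\in\mathcal{U}_{\leq0}$ consists of morphisms $\iota_n\colon X_n\to X$ and $\phi_n\colon X_n\to X_{n+1}$ ($n\geq0$) with $X_n\in\mathcal{U}_{[-n,0]}$, the cone of $\iota_n$ in $\mathcal{U}_{\leq-n-1}$, the cone of $\phi_n$ in $\Sigma^{n+1}(\mathcal{C})$, and $\iota_n=\iota_{n+1}\circ\phi_n$. A right tower of $Y\in\mathcal{U}_{\geq0}$ consists of morphisms $\pi_n\colon Y\to Y_n$ and $\psi_n\colon Y_{n+1}\to Y_n$ ($n\geq0$) with $Y_n\in\mathcal{U}_{[0,n]}$, the cone of $\pi_n$ in $\mathcal{U}_{\geq n}$, the cone of $\psi_n$ in $\Sigma^{-n}(\mathcal{C})$, and $\pi_n=\psi_n\circ\pi_{n+1}$. $\mathcal{T}$ is bi-complete if it has arbitrary coproducts and products. The homotopy colimit of $\{\phi_n\}$ is given by an exact triangle $\coprod X_n\xrightarrow{1-\phi}\coprod X_n\xrightarrow{\gamma}\mathrm{hocolim}\,X_n\to\Sigma(\coprod X_n)$ (where $1-\phi$ restricted to $X_n$ is $({\rm Id}_{X_n},-\phi_n)^t\colon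 X_n\to X_n\oplus X_{n+1}$ followed by the inclusion), and $\gamma_n$ is the restriction of $\gamma$ to $X_n$. The homotopy limit of $\{\psi_n\}$ is given by an exact triangle $\mathrm{holim}\,Y_n\xrightarrow{\sigma}\prod Y_n\xrightarrow{1-\psi}\prod Y_n\to\Sigma(\mathrm{holim}\,Y_n)$ (dually, the $n$-th component of $1-\psi$ is the projection to $Y_n\oplus Y_{n+1}$ followed by $({\rm Id}_{Y_n},-\psi_n)$), and $\sigma_n$ is the $n$-th component of $\sigma$. A left tower is convergent if there is an isomorphism $\kappa\colon\mathrm{hocolim}\,X_n\to X$ with $\kappa\circ\gamma_n=\iota_n$ for all $n$; a right tower is convergent if there is an isomorphism $\lambda\colon Y\to\mathrm{holim}\,Y_n$ with $\sigma_n\circ\lambda=\pi_n$ for all $n$. The pre-weight structure is left (resp. right) convergent if each object of $\mathcal{U}_{\leq0}$ (resp. $\mathcal{U}_{\geq0}$) admits a convergent left (resp. right) tower, and two-sided convergent if it is both. *)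

theory Defs
  imports "HOL-Library.Equipollence" "HOL-Algebra.Group"
begin

section \<open>Categories\<close>

record ('o, 'm) category =
  Obj :: "'o set"
  Arr :: "'m set"
  Dom :: "'m \<Rightarrow> 'o"
  Cod :: "'m \<Rightarrow> 'o"
  Ident :: "'o \<Rightarrow> 'm"
  Comp :: "'m \<Rightarrow> 'm \<Rightarrow> 'm"  (infixr "\<cdot>\<index>" 70)

definition Hom :: "('o, 'm, 'x) category_scheme \<Rightarrow> 'o \<Rightarrow> 'o \<Rightarrow> 'm set" where
  "Hom C X Y = {f \<in> Arr C. Dom C f = X \<and> Cod C f = Y}"

locale category =
  fixes C :: "('o, 'm, 'x) category_scheme" (structure)
  assumes dom_closed: "f \<in> Arr C \<Longrightarrow> Dom C f \<in> Obj C"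
    and cod_closed: "f \<in> Arr C \<Longrightarrow> Cod C f \<in> Obj C"
    and ident_closed: "X \<in> Obj C \<Longrightarrow> Ident C X \<in> Hom C X X"
    and comp_closed: "\<lbrakk>f \<in> Hom C X Y; g \<in> Hom C Y Z\<rbrakk> \<Longrightarrow> g \<cdot> f \<in> Hom C X Z"
    and comp_assoc: "\<lbrakk>f \<in> Hom C W X; g \<in> Hom C X Y; h \<in> Hom C Y Z\<rbrakk>
      \<Longrightarrow> (h \<cdot> g) \<cdot> f = h \<cdot> (g \<cdot> f)"
    and ident_left: "f \<in> Hom C X Y \<Longrightarrow> Ident C Y \<cdot> f = f"
    and ident_right: "f \<in> Hom C X Y \<Longrightarrow> f \<cdot> Ident C X = f"

definition is_iso :: "('o, 'm, 'x) category_scheme \<Rightarrow> 'o \<Rightarrow> 'o \<Rightarrow> 'm \<Rightarrow> bool" where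
  "is_iso C X Y f \<longleftrightarrow> f \<in> Hom C X Y \<and>
     (\<exists>g \<in> Hom C Y X. Comp C g f = Ident C X \<and> Comp C f g = Ident C Y)"

definition isomorphic :: "('o, 'm, 'x) category_scheme \<Rightarrow> 'o \<Rightarrow> 'o \<Rightarrow> bool" where
  "isomorphic C X Y \<longleftrightarrow> (\<exists>f. is_iso C X Y f)"

definition zero_object :: "('o, 'm, 'x) category_scheme \<Rightarrow> 'o \<Rightarrow> bool" where
  "zero_object C Z \<longleftrightarrow> Z \<in> Obj C \<and>
     (\<forall>X \<in> Obj C. (\<exists>!f. f \<in> Hom C X Z) \<and> (\<exists>!f. f \<in> Hom C Z X))"

definition is_coproduct ::
  "('o, 'm, 'x) category_scheme \<Rightarrow> 'i set \<Rightarrow> ('i \<Rightarrow> 'o) \<Rightarrow> 'o \<Rightarrow> ('i \<Rightarrow> 'm) \<Rightarrow> bool" where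
  "is_coproduct C I X P inc \<longleftrightarrow> P \<in> Obj C \<and> (\<forall>i \<in> I. inc i \<in> Hom C (X i) P) \<and>
     (\<forall>W \<in> Obj C. \<forall>f. (\<forall>i \<in> I. f i \<in> Hom C (X i) W) \<longrightarrow>
        (\<exists>!u. u \<in> Hom C P W \<and> (\<forall>i \<in> I. Comp C u (inc i) = f i)))"

definition is_product ::
  "('o, 'm, 'x) category_scheme \<Rightarrow> 'i set \<Rightarrow> ('i \<Rightarrow> 'o) \<Rightarrow> 'o \<Rightarrow> ('i \<Rightarrow> 'm) \<Rightarrow> bool" where
  "is_product C I X P pr \<longleftrightarrow> P \<in> Obj C \<and> (\<forall>i \<in> I. pr i \<in> Hom C P (X i)) \<and>
     (\<forall>W \<in> Obj C. \<forall>f. (\<forall>i \<in> I. f i \<in> Hom C W (X i)) \<longrightarrow>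
        (\<exists>!u. u \<in> Hom C W P \<and> (\<forall>i \<in> I. Comp C (pr i) u = f i)))"

text \<open>
  ``Arbitrary'' coproducts and products are those indexed by small sets. Since the objects of a
  category here form a set of some type, smallness has to be a parameter (quantifying over all
  subsets of a type as large as the type of morphisms would force the category to be a preorder).
  A notion of smallness is a predicate on the subsets of an index type that is closed under passing
  to sets of at most the same cardinality and admits an infinite set, hence all countable sets
  over that type. If the elements of the index type are the sets of ZFC, the usual reading is the
  instance where the small sets are those in bijection with a ZFC set.
\<close>

definition smallness :: "('i set \<Rightarrow> bool) \<Rightarrow> bool" where
  "smallness small \<longleftrightarrow> (\<exists>I. infinite I \<and> small I) \<and> (\<forall>I J. small I \<and> J \<lesssim> I \<longrightarrow> small J)"

definition bicomplete :: "('i set \<Rightarrow> bool) \<Rightarrow> ('o, 'm, 'x) category_scheme \<Rightarrow> bool" where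
  "bicomplete small C \<longleftrightarrow> (\<forall>I (X :: 'i \<Rightarrow> 'o). small I \<and> (\<forall>i \<in> I. X i \<in> Obj C) \<longrightarrow>
     (\<exists>P inc. is_coproduct C I X P inc) \<and> (\<exists>P pr. is_product C I X P pr))"

definition endofunctor ::
  "('o, 'm, 'x) category_scheme \<Rightarrow> ('o \<Rightarrow> 'o) \<Rightarrow> ('m \<Rightarrow> 'm) \<Rightarrow> bool" where
  "endofunctor C Fo Fm \<longleftrightarrow>
     (\<forall>X \<in> Obj C. Fo X \<in> Obj C \<and> Fm (Ident C X) = Ident C (Fo X)) \<and>
     (\<forall>X Y. \<forall>f \<in> Hom C X Y. Fm f \<in> Hom C (Fo X) (Fo Y)) \<and>
     (\<forall>X Y Z. \<forall>f \<in> Hom C X Y. \<forall>g \<in> Hom C Y Z. Fm (Comp C g f) = Comp C (Fm g) (Fm f))"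

definition natural_iso ::
  "('o, 'm, 'x) category_scheme \<Rightarrow> ('o \<Rightarrow> 'o) \<Rightarrow> ('m \<Rightarrow> 'm) \<Rightarrow> ('o \<Rightarrow> 'o) \<Rightarrow> ('m \<Rightarrow> 'm) \<Rightarrow>
   ('o \<Rightarrow> 'm) \<Rightarrow> bool" where
  "natural_iso C Fo Fm Go Gm \<eta> \<longleftrightarrow>
     (\<forall>X \<in> Obj C. is_iso C (Fo X) (Go X) (\<eta> X)) \<and>
     (\<forall>X Y. \<forall>f \<in> Hom C X Y. Comp C (\<eta> Y) (Fm f) = Comp C (Gm f) (\<eta> X))"


section \<open>Additive categories\<close>

record ('o, 'm) additive_category = "('o, 'm) category" +
  Plus :: "'m \<Rightarrow> 'm \<Rightarrow> 'm"  (infixl "\<oplus>\<^sub>m\<index>" 65)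
  Zero :: "'o \<Rightarrow> 'o \<Rightarrow> 'm"

definition Hom_group :: "('o, 'm, 'x) additive_category_scheme \<Rightarrow> 'o \<Rightarrow> 'o \<Rightarrow> 'm monoid" where
  "Hom_group A X Y = \<lparr>carrier = Hom A X Y, mult = Plus A, one = Zero A X Y\<rparr>"

definition Neg :: "('o, 'm, 'x) additive_category_scheme \<Rightarrow> 'm \<Rightarrow> 'm" where
  "Neg A f = inv\<^bsub>Hom_group A (Dom A f) (Cod A f)\<^esub> f"

definition Minus :: "('o, 'm, 'x) additive_category_scheme \<Rightarrow> 'm \<Rightarrow> 'm \<Rightarrow> 'm" where
  "Minus A f g = Plus A f (Neg A g)"

definition direct_sum :: "('o, 'm, 'x) additive_category_scheme \<Rightarrow> 'o \<Rightarrow> 'o \<Rightarrow> 'o \<Rightarrow> bool" where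
  "direct_sum A X Y S \<longleftrightarrow> S \<in> Obj A \<and>
     (\<exists>i \<in> Hom A X S. \<exists>j \<in> Hom A Y S. \<exists>p \<in> Hom A S X. \<exists>q \<in> Hom A S Y.
        Comp A p i = Ident A X \<and> Comp A q j = Ident A Y \<and>
        Comp A p j = Zero A Y X \<and> Comp A q i = Zero A X Y \<and>
        Plus A (Comp A i p) (Comp A j q) = Ident A S)"

locale additive_category = category A
  for A :: "('o, 'm, 'x) additive_category_scheme" (structure) +
  assumes Hom_comm_group: "\<lbrakk>X \<in> Obj A; Y \<in> Obj A\<rbrakk> \<Longrightarrow> comm_group (Hom_group A X Y)"
    and comp_plus_left: "\<lbrakk>f \<in> Hom A X Y; g \<in> Hom A Y Z; g' \<in> Hom A Y Z\<rbrakk>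
      \<Longrightarrow> (g \<oplus>\<^sub>m g') \<cdot> f = (g \<cdot> f) \<oplus>\<^sub>m (g' \<cdot> f)"
    and comp_plus_right: "\<lbrakk>f \<in> Hom A X Y; f' \<in> Hom A X Y; g \<in> Hom A Y Z\<rbrakk>
      \<Longrightarrow> g \<cdot> (f \<oplus>\<^sub>m f') = (g \<cdot> f) \<oplus>\<^sub>m (g \<cdot> f')"
    and ex_zero_object: "\<exists>Z. zero_object A Z"
    and ex_direct_sum: "\<lbrakk>X \<in> Obj A; Y \<in> Obj A\<rbrakk> \<Longrightarrow> \<exists>S. direct_sum A X Y S"

text \<open>A full subcategory is represented by its set of objects.\<close>

definition full_additive_subcategory ::
  "('o, 'm, 'x) additive_category_scheme \<Rightarrow> 'o set \<Rightarrow> bool" where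
  "full_additive_subcategory A \<U> \<longleftrightarrow> \<U> \<subseteq> Obj A \<and> (\<exists>Z \<in> \<U>. zero_object A Z) \<and>
     (\<forall>X \<in> \<U>. \<forall>Y \<in> \<U>. \<exists>S \<in> \<U>. direct_sum A X Y S)"

definition Hom_vanish ::
  "('o, 'm, 'x) additive_category_scheme \<Rightarrow> 'o set \<Rightarrow> 'o set \<Rightarrow> bool" where
  "Hom_vanish A \<X> \<Y> \<longleftrightarrow> (\<forall>X \<in> \<X>. \<forall>Y \<in> \<Y>. Hom A X Y = {Zero A X Y})"


section \<open>Triangulated categories\<close>

text \<open>
  The suspension functor is only required to be an auto-equivalence; \<open>Desusp_obj\<close> and
  \<open>Desusp_arr\<close> are a chosen quasi-inverse. A member \<open>(f, g, h)\<close> of \<open>Exact\<close> stands for the exact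
  triangle \<open>X \<rightarrow> Y \<rightarrow> Z \<rightarrow> \<Sigma>(X)\<close> with morphisms \<open>f\<close>, \<open>g\<close>, \<open>h\<close>.
\<close>

record ('o, 'm) triangulated_category = "('o, 'm) additive_category" +
  Susp_obj :: "'o \<Rightarrow> 'o"
  Susp_arr :: "'m \<Rightarrow> 'm"
  Desusp_obj :: "'o \<Rightarrow> 'o"
  Desusp_arr :: "'m \<Rightarrow> 'm"
  Exact :: "('m \<times> 'm \<times> 'm) set"

definition is_triangle ::
  "('o, 'm, 'x) triangulated_category_scheme \<Rightarrow> 'm \<Rightarrow> 'm \<Rightarrow> 'm \<Rightarrow> bool" where
  "is_triangle T f g h \<longleftrightarrow> f \<in> Arr T \<and> g \<in> Arr T \<and> h \<in> Arr T \<and>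
     Dom T g = Cod T f \<and> Dom T h = Cod T g \<and> Cod T h = Susp_obj T (Dom T f)"

locale triangulated_category = additive_category T
  for T :: "('o, 'm, 'x) triangulated_category_scheme" (structure) +
  assumes susp_functor: "endofunctor T (Susp_obj T) (Susp_arr T)"
    and desusp_functor: "endofunctor T (Desusp_obj T) (Desusp_arr T)"
    and susp_additive: "\<lbrakk>f \<in> Hom T X Y; f' \<in> Hom T X Y\<rbrakk>
      \<Longrightarrow> Susp_arr T (f \<oplus>\<^sub>m f') = Susp_arr T f \<oplus>\<^sub>m Susp_arr T f'"
    and desusp_susp: "\<exists>\<eta>. natural_iso T id id
      (Desusp_obj T \<circ> Susp_obj T) (Desusp_arr T \<circ> Susp_arr T) \<eta>"
    and susp_desusp: "\<exists>\<epsilon>. natural_iso T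
      (Susp_obj T \<circ> Desusp_obj T) (Susp_arr T \<circ> Desusp_arr T) id id \<epsilon>"
    and exact_triangle: "(f, g, h) \<in> Exact T \<Longrightarrow> is_triangle T f g h"
    and exact_iso: "\<lbrakk>(f, g, h) \<in> Exact T; is_triangle T f' g' h';
        is_iso T (Dom T f) (Dom T f') u; is_iso T (Cod T f) (Cod T f') v;
        is_iso T (Cod T g) (Cod T g') w;
        v \<cdot> f = f' \<cdot> u; w \<cdot> g = g' \<cdot> v; Susp_arr T u \<cdot> h = h' \<cdot> w\<rbrakk>
      \<Longrightarrow> (f', g', h') \<in> Exact T"
    and TR1_ident: "\<lbrakk>X \<in> Obj T; zero_object T Z\<rbrakk>
      \<Longrightarrow> (Ident T X, Zero T X Z, Zero T Z (Susp_obj T X)) \<in> Exact T"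
    and TR1_cone: "f \<in> Arr T \<Longrightarrow> \<exists>g h. (f, g, h) \<in> Exact T"
    and TR2: "is_triangle T f g h
      \<Longrightarrow> (f, g, h) \<in> Exact T \<longleftrightarrow> (g, h, Neg T (Susp_arr T f)) \<in> Exact T"
    and TR3: "\<lbrakk>(f, g, h) \<in> Exact T; (f', g', h') \<in> Exact T;
        u \<in> Hom T (Dom T f) (Dom T f'); v \<in> Hom T (Cod T f) (Cod T f'); v \<cdot> f = f' \<cdot> u\<rbrakk>
      \<Longrightarrow> \<exists>w \<in> Hom T (Cod T g) (Cod T g'). w \<cdot> g = g' \<cdot> v \<and> Susp_arr T u \<cdot> h = h' \<cdot> w"
    and TR4: "\<lbrakk>f \<in> Hom T X Y; g \<in> Hom T Y Z;
        (f, f\<^sub>1, f\<^sub>2) \<in> Exact T; (g, g\<^sub>1, g\<^sub>2) \<in> Exact T; (g \<cdot> f, k\<^sub>1, k\<^sub>2) \<in> Exact T\<rbrakk>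
      \<Longrightarrow> \<exists>a \<in> Hom T (Cod T f\<^sub>1) (Cod T k\<^sub>1). \<exists>b \<in> Hom T (Cod T k\<^sub>1) (Cod T g\<^sub>1).
        (a, b, Susp_arr T f\<^sub>1 \<cdot> g\<^sub>2) \<in> Exact T \<and>
        a \<cdot> f\<^sub>1 = k\<^sub>1 \<cdot> g \<and> k\<^sub>2 \<cdot> a = f\<^sub>2 \<and> b \<cdot> k\<^sub>1 = g\<^sub>1 \<and> g\<^sub>2 \<cdot> b = Susp_arr T f \<cdot> k\<^sub>2"

definition Susp_pow :: "('o, 'm, 'x) triangulated_category_scheme \<Rightarrow> int \<Rightarrow> 'o \<Rightarrow> 'o" where
  "Susp_pow T k = (if 0 \<le> k then Susp_obj T ^^ nat k else Desusp_obj T ^^ nat (- k))"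

text \<open>
  The full subcategory \<open>\<Sigma>\<^sup>k(\<U>)\<close>. As \<open>\<Sigma>\<close> need not be invertible on the nose, this is the essential
  image, which for an automorphism \<open>\<Sigma>\<close> and an isomorphism-closed \<open>\<U>\<close> is the image itself.
\<close>

definition Susp_image ::
  "('o, 'm, 'x) triangulated_category_scheme \<Rightarrow> int \<Rightarrow> 'o set \<Rightarrow> 'o set" where
  "Susp_image T k \<U> = {Z \<in> Obj T. \<exists>X \<in> \<U>. isomorphic T Z (Susp_pow T k X)}"

definition extensions ::
  "('o, 'm, 'x) triangulated_category_scheme \<Rightarrow> 'o set \<Rightarrow> 'o set \<Rightarrow> 'o set" where
  "extensions T \<X> \<Y> = {Z \<in> Obj T. \<exists>X \<in> \<X>. \<exists>Y \<in> \<Y>. \<exists>f \<in> Hom T X Z. \<exists>g \<in> Hom T Z Y. \<exists>h.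
     (f, g, h) \<in> Exact T}"

definition cone_in :: "('o, 'm, 'x) triangulated_category_scheme \<Rightarrow> 'm \<Rightarrow> 'o set \<Rightarrow> bool" where
  "cone_in T f \<U> \<longleftrightarrow> (\<exists>g h. (f, g, h) \<in> Exact T \<and> Cod T g \<in> \<U>)"

text \<open>
  \<open>is_hocolim T X \<phi> H \<gamma>\<close>: \<open>H\<close> is a homotopy colimit of the sequence \<open>\<phi> n : X n \<rightarrow> X (n + 1)\<close>, and
  \<open>\<gamma> n : X n \<rightarrow> H\<close> are the restrictions of the second morphism \<open>c\<close> of the defining triangle. Its first
  morphism \<open>d\<close> is \<open>1 - \<phi>\<close>. The definition of \<open>is_holim\<close> is dual.
\<close>

definition is_hocolim ::
  "('o, 'm, 'x) triangulated_category_scheme \<Rightarrow> (nat \<Rightarrow> 'o) \<Rightarrow> (nat \<Rightarrow> 'm) \<Rightarrow> 'o \<Rightarrow> (nat \<Rightarrow> 'm) \<Rightarrow> bool"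
  where
  "is_hocolim T X \<phi> H \<gamma> \<longleftrightarrow> (\<exists>P inc d c e. is_coproduct T UNIV X P inc \<and>
     d \<in> Hom T P P \<and> (\<forall>n. Comp T d (inc n) = Minus T (inc n) (Comp T (inc (n + 1)) (\<phi> n))) \<and>
     c \<in> Hom T P H \<and> (d, c, e) \<in> Exact T \<and> (\<forall>n. \<gamma> n = Comp T c (inc n)))"

definition is_holim ::
  "('o, 'm, 'x) triangulated_category_scheme \<Rightarrow> (nat \<Rightarrow> 'o) \<Rightarrow> (nat \<Rightarrow> 'm) \<Rightarrow> 'o \<Rightarrow> (nat \<Rightarrow> 'm) \<Rightarrow> bool"
  where
  "is_holim T Y \<psi> H \<sigma> \<longleftrightarrow> (\<exists>P pr d s e. is_product T UNIV Y P pr \<and>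
     d \<in> Hom T P P \<and> (\<forall>n. Comp T (pr n) d = Minus T (pr n) (Comp T (\<psi> n) (pr (n + 1)))) \<and>
     s \<in> Hom T H P \<and> (s, d, e) \<in> Exact T \<and> (\<forall>n. \<sigma> n = Comp T (pr n) s))"


section \<open>Pre-weight structures\<close>

text \<open>The subcategories \<open>\<U>\<^bsub>\<ge>0\<^esub>\<close> and \<open>\<U>\<^bsub>\<le>0\<^esub>\<close> are written \<open>Uge\<close> and \<open>Ule\<close>.\<close>

definition pre_weight_structure ::
  "('o, 'm, 'x) triangulated_category_scheme \<Rightarrow> 'o set \<Rightarrow> 'o set \<Rightarrow> bool" where
  "pre_weight_structure T Uge Ule \<longleftrightarrow>
     full_additive_subcategory T Uge \<and> full_additive_subcategory T Ule \<and>
     extensions T Uge (Susp_image T 1 Ule) = Obj T \<and>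
     Desusp_obj T ` Uge \<subseteq> Uge \<and> extensions T Uge Uge \<subseteq> Uge \<and>
     Susp_obj T ` Ule \<subseteq> Ule \<and> extensions T Ule Ule \<subseteq> Ule"

definition core :: "'o set \<Rightarrow> 'o set \<Rightarrow> 'o set" where
  "core Uge Ule = Uge \<inter> Ule"

definition U_ge :: "('o, 'm, 'x) triangulated_category_scheme \<Rightarrow> 'o set \<Rightarrow> int \<Rightarrow> 'o set" where
  "U_ge T Uge m = Susp_image T (- m) Uge"

definition U_le :: "('o, 'm, 'x) triangulated_category_scheme \<Rightarrow> 'o set \<Rightarrow> int \<Rightarrow> 'o set" where
  "U_le T Ule m = Susp_image T (- m) Ule"

definition U_interval ::
  "('o, 'm, 'x) triangulated_category_scheme \<Rightarrow> 'o set \<Rightarrow> 'o set \<Rightarrow> int \<Rightarrow> int \<Rightarrow> 'o set" where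
  "U_interval T Uge Ule m n = U_ge T Uge m \<inter> U_le T Ule n"

definition left_tower ::
  "('o, 'm, 'x) triangulated_category_scheme \<Rightarrow> 'o set \<Rightarrow> 'o set \<Rightarrow>
   'o \<Rightarrow> (nat \<Rightarrow> 'o) \<Rightarrow> (nat \<Rightarrow> 'm) \<Rightarrow> (nat \<Rightarrow> 'm) \<Rightarrow> bool" where
  "left_tower T Uge Ule X Xs \<iota> \<phi> \<longleftrightarrow> X \<in> Ule \<and>
     (\<forall>n. \<iota> n \<in> Hom T (Xs n) X \<and> \<phi> n \<in> Hom T (Xs n) (Xs (n + 1)) \<and>
        Xs n \<in> U_interval T Uge Ule (- int n) 0 \<and>
        cone_in T (\<iota> n) (U_le T Ule (- int n - 1)) \<and>
        cone_in T (\<phi> n) (Susp_image T (int n + 1) (core Uge Ule)) \<and>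
        \<iota> n = Comp T (\<iota> (n + 1)) (\<phi> n))"

definition right_tower ::
  "('o, 'm, 'x) triangulated_category_scheme \<Rightarrow> 'o set \<Rightarrow> 'o set \<Rightarrow>
   'o \<Rightarrow> (nat \<Rightarrow> 'o) \<Rightarrow> (nat \<Rightarrow> 'm) \<Rightarrow> (nat \<Rightarrow> 'm) \<Rightarrow> bool" where
  "right_tower T Uge Ule Y Ys \<pi> \<psi> \<longleftrightarrow> Y \<in> Uge \<and>
     (\<forall>n. \<pi> n \<in> Hom T Y (Ys n) \<and> \<psi> n \<in> Hom T (Ys (n + 1)) (Ys n) \<and>
        Ys n \<in> U_interval T Uge Ule 0 (int n) \<and>
        cone_in T (\<pi> n) (U_ge T Uge (int n)) \<and>
        cone_in T (\<psi> n) (Susp_image T (- int n) (core Uge Ule)) \<and>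
        \<pi> n = Comp T (\<psi> n) (\<pi> (n + 1)))"

definition convergent_left_tower ::
  "('o, 'm, 'x) triangulated_category_scheme \<Rightarrow> 'o set \<Rightarrow> 'o set \<Rightarrow>
   'o \<Rightarrow> (nat \<Rightarrow> 'o) \<Rightarrow> (nat \<Rightarrow> 'm) \<Rightarrow> (nat \<Rightarrow> 'm) \<Rightarrow> bool" where
  "convergent_left_tower T Uge Ule X Xs \<iota> \<phi> \<longleftrightarrow> left_tower T Uge Ule X Xs \<iota> \<phi> \<and>
     (\<exists>H \<gamma> \<kappa>. is_hocolim T Xs \<phi> H \<gamma> \<and> is_iso T H X \<kappa> \<and> (\<forall>n. Comp T \<kappa> (\<gamma> n) = \<iota> n))"

definition convergent_right_tower ::
  "('o, 'm, 'x) triangulated_category_scheme \<Rightarrow> 'o set \<Rightarrow> 'o set \<Rightarrow>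
   'o \<Rightarrow> (nat \<Rightarrow> 'o) \<Rightarrow> (nat \<Rightarrow> 'm) \<Rightarrow> (nat \<Rightarrow> 'm) \<Rightarrow> bool" where
  "convergent_right_tower T Uge Ule Y Ys \<pi> \<psi> \<longleftrightarrow> right_tower T Uge Ule Y Ys \<pi> \<psi> \<and>
     (\<exists>H \<sigma> \<theta>. is_holim T Ys \<psi> H \<sigma> \<and> is_iso T Y H \<theta> \<and> (\<forall>n. Comp T (\<sigma> n) \<theta> = \<pi> n))"

definition left_convergent ::
  "('o, 'm, 'x) triangulated_category_scheme \<Rightarrow> 'o set \<Rightarrow> 'o set \<Rightarrow> bool" where
  "left_convergent T Uge Ule \<longleftrightarrow>
     (\<forall>X \<in> Ule. \<exists>Xs \<iota> \<phi>. convergent_left_tower T Uge Ule X Xs \<iota> \<phi>)"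

definition right_convergent ::
  "('o, 'm, 'x) triangulated_category_scheme \<Rightarrow> 'o set \<Rightarrow> 'o set \<Rightarrow> bool" where
  "right_convergent T Uge Ule \<longleftrightarrow>
     (\<forall>Y \<in> Uge. \<exists>Ys \<pi> \<psi>. convergent_right_tower T Uge Ule Y Ys \<pi> \<psi>)"

definition two_sided_convergent ::
  "('o, 'm, 'x) triangulated_category_scheme \<Rightarrow> 'o set \<Rightarrow> 'o set \<Rightarrow> bool" where
  "two_sided_convergent T Uge Ule \<longleftrightarrow> left_convergent T Uge Ule \<and> right_convergent T Uge Ule"

end

theory Submission imports Defs begin

text \<open>
  Towers reduce everything to the core, and no derived limit has to be computed: if
  \<open>Hom(A, Y\<^sub>n)\<close> and \<open>Hom(\<Sigma>A, Y\<^sub>n)\<close> vanish for all \<open>n\<close>, then so does \<open>Hom(A, holim Y\<^sub>n)\<close>, and dually.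
  For \<open>C\<close> in the core, the groups \<open>Hom(\<Sigma>C, Y\<^sub>n)\<close> and \<open>Hom(\<Sigma>\<^sup>2C, Y\<^sub>n)\<close> of a right tower vanish by
  induction on \<open>n\<close>; hence \<open>Hom(C, \<U>\<^bsub>\<ge>1\<^esub>) = 0\<close>. As \<open>\<U>\<^bsub>\<ge>1\<^esub>\<close> is closed under \<open>\<Sigma>\<^sup>-\<^sup>1\<close>, induction along a
  left tower of \<open>X\<close> gives \<open>Hom(X\<^sub>n, B) = 0 = Hom(\<Sigma>X\<^sub>n, B)\<close> for all \<open>B\<close> in \<open>\<U>\<^bsub>\<ge>1\<^esub>\<close>.
\<close>

section \<open>Isomorphisms and zero morphisms\<close>

context category
begin

lemma Hom_obj:
  assumes "f \<in> Hom C X Y"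
  shows "X \<in> Obj C" "Y \<in> Obj C"
  using assms dom_closed cod_closed by (auto simp: Hom_def)

lemma is_iso_cancel_left:
  assumes "is_iso C Y Z e" "f \<in> Hom C X Y" "g \<in> Hom C X Y" "e \<cdot> f = e \<cdot> g"
  shows "f = g"
proof -
  from assms(1) obtain e' where e: "e \<in> Hom C Y Z" "e' \<in> Hom C Z Y" "e' \<cdot> e = Ident C Y"
    by (auto simp: is_iso_def)
  have "e' \<cdot> (e \<cdot> f) = f" "e' \<cdot> (e \<cdot> g) = g"
    using comp_assoc[OF assms(2) e(1,2)] comp_assoc[OF assms(3) e(1,2)] e(3)
      ident_left[OF assms(2)] ident_left[OF assms(3)] by metis+
  then show ?thesis
    using assms(4) by metis
qed

lemma is_iso_cancel_right:
  assumes "is_iso C X Y e" "f \<in> Hom C Y Z" "g \<in> Hom C Y Z" "f \<cdot> e = g \<cdot> e"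
  shows "f = g"
proof -
  from assms(1) obtain e' where e: "e \<in> Hom C X Y" "e' \<in> Hom C Y X" "e \<cdot> e' = Ident C Y"
    by (auto simp: is_iso_def)
  have "(f \<cdot> e) \<cdot> e' = f" "(g \<cdot> e) \<cdot> e' = g"
    using comp_assoc[OF e(2,1) assms(2)] comp_assoc[OF e(2,1) assms(3)] e(3)
      ident_right[OF assms(2)] ident_right[OF assms(3)] by metis+
  then show ?thesis
    using assms(4) by metis
qed

lemma is_iso_Ident: "X \<in> Obj C \<Longrightarrow> is_iso C X X (Ident C X)"
  unfolding is_iso_def using ident_closed ident_left by blast

lemma isomorphic_refl: "X \<in> Obj C \<Longrightarrow> isomorphic C X X"
  unfolding isomorphic_def using is_iso_Ident by (rule exI)

lemma isomorphic_sym: "isomorphic C X Y \<Longrightarrow> isomorphic C Y X"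
  unfolding isomorphic_def is_iso_def by blast

lemma isomorphic_endofunctor:
  assumes "endofunctor C Fo Fm" "isomorphic C X Y"
  shows "isomorphic C (Fo X) (Fo Y)"
proof -
  from assms(2) obtain f g where fg: "f \<in> Hom C X Y" "g \<in> Hom C Y X"
    "g \<cdot> f = Ident C X" "f \<cdot> g = Ident C Y"
    unfolding isomorphic_def is_iso_def by blast
  have "Fm f \<in> Hom C (Fo X) (Fo Y)" "Fm g \<in> Hom C (Fo Y) (Fo X)"
    using assms(1) fg by (auto simp: endofunctor_def)
  moreover have "Fm g \<cdot> Fm f = Ident C (Fo X)" "Fm f \<cdot> Fm g = Ident C (Fo Y)"
    using assms(1) fg Hom_obj[OF fg(1)] unfolding endofunctor_def by metis+
  ultimately show ?thesis
    unfolding isomorphic_def is_iso_def by blast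
qed

end

text \<open>Stated as an inclusion: in a category it holds trivially when \<open>X\<close> or
  \<open>Y\<close> is not an object, since the Hom set is then empty. For objects,
  \<open>Zero_closed\<close> upgrades it to equality.\<close>

definition orthogonal :: "('o, 'm, 'x) additive_category_scheme \<Rightarrow> 'o \<Rightarrow> 'o \<Rightarrow> bool" where
  "orthogonal A X Y \<longleftrightarrow> Hom A X Y \<subseteq> {Zero A X Y}"

lemma orthogonalD: "orthogonal A X Y \<Longrightarrow> f \<in> Hom A X Y \<Longrightarrow> f = Zero A X Y"
  by (auto simp: orthogonal_def)

context additive_category
begin

section \<open>Zero morphisms, negatives and zero objects in an additive category\<close>

lemma Zero_closed:
  assumes "X \<in> Obj A" "Y \<in> Obj A"
  shows "Zero A X Y \<in> Hom A X Y"
proof -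
  interpret G: comm_group "Hom_group A X Y"
    using Hom_comm_group assms by blast
  show ?thesis
    using G.one_closed by (simp add: Hom_group_def)
qed

text \<open>An idempotent of a group is neutral. This is how composition and suspension, being
  additive, are shown to preserve zero morphisms.\<close>

lemma plus_self_imp_Zero:
  assumes f: "f \<in> Hom A X Y" and "f \<oplus>\<^sub>m f = f"
  shows "f = Zero A X Y"
proof -
  interpret G: comm_group "Hom_group A X Y"
    using Hom_comm_group Hom_obj[OF f] by blast
  show ?thesis
    using G.l_cancel_one[of f f] assms by (simp add: Hom_group_def)
qed

lemma Zero_plus_Zero:
  assumes "X \<in> Obj A" "Y \<in> Obj A"
  shows "Zero A X Y \<oplus>\<^sub>m Zero A X Y = Zero A X Y"
proof -
  interpret G: comm_group "Hom_group A X Y"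
    using Hom_comm_group assms by blast
  show ?thesis
    using G.l_one[OF G.one_closed] by (simp add: Hom_group_def)
qed

lemma comp_Zero_right:
  assumes g: "g \<in> Hom A Y Z" and X: "X \<in> Obj A"
  shows "g \<cdot> Zero A X Y = Zero A X Z"
proof -
  have z: "Zero A X Y \<in> Hom A X Y"
    using Zero_closed X Hom_obj[OF g] by blast
  show ?thesis
    using plus_self_imp_Zero[OF comp_closed[OF z g]] comp_plus_right[OF z z g]
      Zero_plus_Zero X Hom_obj[OF g] by simp
qed

lemma comp_Zero_left:
  assumes f: "f \<in> Hom A X Y" and Z: "Z \<in> Obj A"
  shows "Zero A Y Z \<cdot> f = Zero A X Z"
proof -
  have z: "Zero A Y Z \<in> Hom A Y Z"
    using Zero_closed Z Hom_obj[OF f] by blast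
  show ?thesis
    using plus_self_imp_Zero[OF comp_closed[OF f z]] comp_plus_left[OF f z z]
      Zero_plus_Zero Z Hom_obj[OF f] by simp
qed

lemma Neg_closed:
  assumes f: "f \<in> Hom A X Y"
  shows "Neg A f \<in> Hom A X Y"
proof -
  interpret G: comm_group "Hom_group A X Y"
    using Hom_comm_group Hom_obj[OF f] by blast
  show ?thesis
    using G.inv_closed[of f] f by (auto simp: Neg_def Hom_group_def Hom_def)
qed

lemma Neg_eq_Zero_iff:
  assumes f: "f \<in> Hom A X Y"
  shows "Neg A f = Zero A X Y \<longleftrightarrow> f = Zero A X Y"
proof -
  interpret G: comm_group "Hom_group A X Y"
    using Hom_comm_group Hom_obj[OF f] by blast
  have "Neg A f = inv\<^bsub>Hom_group A X Y\<^esub> f"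
    using f by (simp add: Neg_def Hom_def)
  then show ?thesis
    using G.inv_eq_1_iff[of f] f by (simp add: Hom_group_def)
qed

text \<open>By additivity of composition, the left side is an additive inverse of
  \<open>g \<cdot> f\<close>. It serves to remove the sign produced by rotating a triangle.\<close>

lemma comp_Neg_right:
  assumes f: "f \<in> Hom A X Y" and g: "g \<in> Hom A Y Z"
  shows "g \<cdot> Neg A f = Neg A (g \<cdot> f)"
proof -
  have objs: "X \<in> Obj A" "Y \<in> Obj A" "Z \<in> Obj A"
    using Hom_obj f g by auto
  interpret G: comm_group "Hom_group A X Y"
    using Hom_comm_group objs by blast
  interpret H: comm_group "Hom_group A X Z"
    using Hom_comm_group objs by blast
  note nf = Neg_closed[OF f] and gf = comp_closed[OF f g]
  have "Neg A f = inv\<^bsub>Hom_group A X Y\<^esub> f" "Neg A (g \<cdot> f) = inv\<^bsub>Hom_group A X Z\<^esub> (g \<cdot> f)"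
    using f gf by (simp_all add: Neg_def Hom_def)
  moreover have "Neg A f \<oplus>\<^sub>m f = Zero A X Y"
    using G.l_inv[of f] f calculation(1) by (simp add: Hom_group_def)
  then have "(g \<cdot> Neg A f) \<oplus>\<^sub>m (g \<cdot> f) = Zero A X Z"
    using comp_plus_right[OF nf f g] comp_Zero_right[OF g objs(1)] by simp
  ultimately show ?thesis
    using H.inv_equality[of "g \<cdot> Neg A f" "g \<cdot> f"] gf comp_closed[OF nf g]
    by (simp add: Hom_group_def)
qed

lemma zero_object_Obj: "zero_object A Z \<Longrightarrow> Z \<in> Obj A"
  by (simp add: zero_object_def)

lemma zero_object_Hom:
  assumes "zero_object A Z" "X \<in> Obj A"
  shows "f \<in> Hom A X Z \<Longrightarrow> f = Zero A X Z" "g \<in> Hom A Z X \<Longrightarrow> g = Zero A Z X"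
  using assms Zero_closed unfolding zero_object_def by metis+

text \<open>An equational form that additive functors visibly preserve; it carries zero objects
  through the suspension.\<close>

lemma zero_object_iff: "zero_object A Z \<longleftrightarrow> Z \<in> Obj A \<and> Ident A Z = Zero A Z Z"
proof
  assume "zero_object A Z"
  then show "Z \<in> Obj A \<and> Ident A Z = Zero A Z Z"
    using zero_object_Hom zero_object_Obj ident_closed by blast
next
  assume Z: "Z \<in> Obj A \<and> Ident A Z = Zero A Z Z"
  have "f = Zero A X Z" if "f \<in> Hom A X Z" for f X
    using that Z ident_left comp_Zero_left by metis
  moreover have "f = Zero A Z X" if "f \<in> Hom A Z X" for f X
    using that Z ident_right comp_Zero_right by metis
  ultimately show "zero_object A Z"
    using Z Zero_closed unfolding zero_object_def by blast
qed

section \<open>Orthogonality under isomorphisms, coproducts and products\<close>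

lemma orthogonal_isomorphic_left:
  assumes iso: "isomorphic A X X'" and orth: "orthogonal A X' Y"
  shows "orthogonal A X Y"
  unfolding orthogonal_def
proof
  fix f assume f: "f \<in> Hom A X Y"
  from iso obtain u v where uv: "u \<in> Hom A X X'" "v \<in> Hom A X' X" "v \<cdot> u = Ident A X"
    by (auto simp: isomorphic_def is_iso_def)
  \<comment> \<open>\<open>f\<close> is factored through \<open>X'\<close>, from which every
    morphism to \<open>Y\<close> vanishes.\<close>
  have "f = (f \<cdot> v) \<cdot> u"
    using comp_assoc[OF uv(1,2) f] uv(3) ident_right[OF f] by metis
  also have "f \<cdot> v = Zero A X' Y"
    using orthogonalD[OF orth comp_closed[OF uv(2) f]] .
  finally show "f \<in> {Zero A X Y}"
    using comp_Zero_left[OF uv(1)] Hom_obj[OF f] by simp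
qed

lemma orthogonal_isomorphic_right:
  assumes iso: "isomorphic A Y Y'" and orth: "orthogonal A X Y'"
  shows "orthogonal A X Y"
  unfolding orthogonal_def
proof
  fix f assume f: "f \<in> Hom A X Y"
  from iso obtain u v where uv: "u \<in> Hom A Y Y'" "v \<in> Hom A Y' Y" "v \<cdot> u = Ident A Y"
    by (auto simp: isomorphic_def is_iso_def)
  have "f = v \<cdot> (u \<cdot> f)"
    using comp_assoc[OF f uv(1,2)] uv(3) ident_left[OF f] by metis
  also have "u \<cdot> f = Zero A X Y'"
    using orthogonalD[OF orth comp_closed[OF f uv(1)]] .
  finally show "f \<in> {Zero A X Y}"
    using comp_Zero_right[OF uv(2)] Hom_obj[OF f] by simp
qed

text \<open>\<open>f\<close> and the zero morphism have the same restriction to every summand, so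
  the uniqueness clause of the universal property identifies them.\<close>

lemma orthogonal_coproduct:
  assumes P: "is_coproduct A I X P inc" and orth: "\<And>i. i \<in> I \<Longrightarrow> orthogonal A (X i) Y"
  shows "orthogonal A P Y"
  unfolding orthogonal_def
proof
  fix f assume f: "f \<in> Hom A P Y"
  have inc: "inc i \<in> Hom A (X i) P" if "i \<in> I" for i
    using P that by (simp add: is_coproduct_def)
  have zero: "Zero A P Y \<in> Hom A P Y" "\<And>i. i \<in> I \<Longrightarrow> Zero A P Y \<cdot> inc i = Zero A (X i) Y"
    using Zero_closed Hom_obj[OF f] comp_Zero_left inc by auto
  have f_inc: "f \<cdot> inc i = Zero A (X i) Y" if "i \<in> I" for i
    using orthogonalD[OF orth comp_closed[OF inc f]] that by blast
  have "\<exists>!u. u \<in> Hom A P Y \<and> (\<forall>i \<in> I. u \<cdot> inc i = Zero A (X i) Y)"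
    using P Hom_obj[OF f] Zero_closed Hom_obj(1)[OF inc] by (simp add: is_coproduct_def)
  then show "f \<in> {Zero A P Y}"
    using f f_inc zero by blast
qed

lemma orthogonal_product:
  assumes P: "is_product A I Y P pr" and orth: "\<And>i. i \<in> I \<Longrightarrow> orthogonal A X (Y i)"
  shows "orthogonal A X P"
  unfolding orthogonal_def
proof
  fix f assume f: "f \<in> Hom A X P"
  have pr: "pr i \<in> Hom A P (Y i)" if "i \<in> I" for i
    using P that by (simp add: is_product_def)
  have zero: "Zero A X P \<in> Hom A X P" "\<And>i. i \<in> I \<Longrightarrow> pr i \<cdot> Zero A X P = Zero A X (Y i)"
    using Zero_closed Hom_obj[OF f] comp_Zero_right pr by auto
  have pr_f: "pr i \<cdot> f = Zero A X (Y i)" if "i \<in> I" for i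
    using orthogonalD[OF orth comp_closed[OF f pr]] that by blast
  have "\<exists>!u. u \<in> Hom A X P \<and> (\<forall>i \<in> I. pr i \<cdot> u = Zero A X (Y i))"
    using P Hom_obj[OF f] Zero_closed Hom_obj(2)[OF pr] by (simp add: is_product_def)
  then show "f \<in> {Zero A X P}"
    using f pr_f zero by blast
qed

end

section \<open>Suspension and exact triangles\<close>

context triangulated_category
begin

abbreviation S where "S \<equiv> Susp_obj T"
abbreviation D where "D \<equiv> Desusp_obj T"

section \<open>The suspension as a faithful additive functor, and moving it across Hom\<close>

lemma Susp_obj_closed: "X \<in> Obj T \<Longrightarrow> S X \<in> Obj T"
  using susp_functor by (simp add: endofunctor_def)

lemma Desusp_obj_closed: "X \<in> Obj T \<Longrightarrow> D X \<in> Obj T"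
  using desusp_functor by (simp add: endofunctor_def)

lemma Susp_arr_closed: "f \<in> Hom T X Y \<Longrightarrow> Susp_arr T f \<in> Hom T (S X) (S Y)"
  using susp_functor by (simp add: endofunctor_def)

lemma Desusp_arr_closed: "f \<in> Hom T X Y \<Longrightarrow> Desusp_arr T f \<in> Hom T (D X) (D Y)"
  using desusp_functor by (simp add: endofunctor_def)

lemma Susp_arr_Zero:
  assumes "X \<in> Obj T" "Y \<in> Obj T"
  shows "Susp_arr T (Zero T X Y) = Zero T (S X) (S Y)"
proof -
  have z: "Zero T X Y \<in> Hom T X Y"
    using assms by (rule Zero_closed)
  show ?thesis
    using plus_self_imp_Zero[OF Susp_arr_closed[OF z]] susp_additive[OF z z]
      Zero_plus_Zero[OF assms] by simp
qed

lemma Susp_arr_Ident: "X \<in> Obj T \<Longrightarrow> Susp_arr T (Ident T X) = Ident T (S X)"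
  using susp_functor by (simp add: endofunctor_def)

lemma zero_object_Susp: "zero_object T Z \<Longrightarrow> zero_object T (S Z)"
  unfolding zero_object_iff
  using Susp_obj_closed Susp_arr_Ident Susp_arr_Zero by metis

text \<open>Naturality expresses \<open>\<eta> Y \<cdot> f\<close> through
  \<open>Susp_arr T f\<close>, and the isomorphism \<open>\<eta> Y\<close> can be cancelled.\<close>

lemma Susp_arr_inject:
  assumes f: "f \<in> Hom T X Y" and g: "g \<in> Hom T X Y" and eq: "Susp_arr T f = Susp_arr T g"
  shows "f = g"
proof -
  obtain \<eta> where \<eta>: "natural_iso T id id (D \<circ> S) (Desusp_arr T \<circ> Susp_arr T) \<eta>"
    using desusp_susp by blast
  have "\<eta> Y \<cdot> f = Desusp_arr T (Susp_arr T f) \<cdot> \<eta> X" "\<eta> Y \<cdot> g = Desusp_arr T (Susp_arr T g) \<cdot> \<eta> X"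
    using \<eta> f g unfolding natural_iso_def by auto
  moreover have "is_iso T Y (D (S Y)) (\<eta> Y)"
    using \<eta> Hom_obj[OF f] unfolding natural_iso_def by auto
  ultimately show ?thesis
    using is_iso_cancel_left f g eq by metis
qed

text \<open>Half of Hom(\<open>S X\<close>, \<open>Y\<close>) = Hom(\<open>X\<close>,
  \<open>D Y\<close>), obtained without triangle identities between \<eta> and \<epsilon>. The
  transpose of \<open>f\<close>, namely its desuspension after \<open>\<eta> X\<close>, vanishes by
  hypothesis; cancelling \<open>\<eta> X\<close> kills the desuspension, and naturality of
  \<epsilon> then kills \<open>f\<close>.\<close>

lemma orthogonal_Susp_if:
  assumes orth: "orthogonal T X (D Y)" and XY: "X \<in> Obj T"
  shows "orthogonal T (S X) Y"
  unfolding orthogonal_def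
proof
  fix f assume f: "f \<in> Hom T (S X) Y"
  obtain \<eta> where "natural_iso T id id (D \<circ> S) (Desusp_arr T \<circ> Susp_arr T) \<eta>"
    using desusp_susp by blast
  then have \<eta>: "is_iso T X (D (S X)) (\<eta> X)"
    using XY by (auto simp: natural_iso_def)
  obtain \<epsilon> where \<epsilon>: "natural_iso T (S \<circ> D) (Susp_arr T \<circ> Desusp_arr T) id id \<epsilon>"
    using susp_desusp by blast
  have objs: "S X \<in> Obj T" "Y \<in> Obj T" "D (S X) \<in> Obj T" "D Y \<in> Obj T"
    using Hom_obj[OF f] Desusp_obj_closed by auto
  have \<epsilon>_iso: "is_iso T (S (D (S X))) (S X) (\<epsilon> (S X))"
    using \<epsilon> objs by (auto simp: natural_iso_def)
  then have \<epsilon>_SX: "\<epsilon> (S X) \<in> Hom T (S (D (S X))) (S X)"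
    by (simp add: is_iso_def)
  have \<epsilon>_Y: "\<epsilon> Y \<in> Hom T (S (D Y)) Y"
    using \<epsilon> objs by (auto simp: natural_iso_def is_iso_def)
  have \<eta>_Hom: "\<eta> X \<in> Hom T X (D (S X))"
    using \<eta> by (simp add: is_iso_def)
  have Df: "Desusp_arr T f \<in> Hom T (D (S X)) (D Y)"
    using f by (rule Desusp_arr_closed)
  have "Desusp_arr T f \<cdot> \<eta> X = Zero T (D (S X)) (D Y) \<cdot> \<eta> X"
    using orthogonalD[OF orth comp_closed[OF \<eta>_Hom Df]] comp_Zero_left[OF \<eta>_Hom] objs by simp
  then have "Desusp_arr T f = Zero T (D (S X)) (D Y)"
    using is_iso_cancel_right[OF \<eta> Df] Zero_closed objs by blast
  moreover have "\<epsilon> Y \<cdot> Susp_arr T (Desusp_arr T f) = f \<cdot> \<epsilon> (S X)"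
    using \<epsilon> f by (auto simp: natural_iso_def)
  ultimately have "f \<cdot> \<epsilon> (S X) = \<epsilon> Y \<cdot> Zero T (S (D (S X))) (S (D Y))"
    using Susp_arr_Zero[OF objs(3,4)] by simp
  also have "\<dots> = Zero T (S X) Y \<cdot> \<epsilon> (S X)"
    using comp_Zero_right[OF \<epsilon>_Y] comp_Zero_left[OF \<epsilon>_SX] objs Susp_obj_closed by simp
  finally show "f \<in> {Zero T (S X) Y}"
    using is_iso_cancel_right[OF \<epsilon>_iso f] Zero_closed objs by blast
qed

text \<open>The other half: suspend \<open>f\<close>, identify \<open>S (D Y)\<close> with
  \<open>Y\<close>, and use faithfulness of the suspension.\<close>

lemma orthogonal_Desusp_if:
  assumes orth: "orthogonal T (S X) Y" and Y: "Y \<in> Obj T"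
  shows "orthogonal T X (D Y)"
  unfolding orthogonal_def
proof
  fix f assume f: "f \<in> Hom T X (D Y)"
  obtain \<epsilon> where "natural_iso T (S \<circ> D) (Susp_arr T \<circ> Desusp_arr T) id id \<epsilon>"
    using susp_desusp by blast
  then have "isomorphic T (S (D Y)) Y"
    using Y by (auto simp: natural_iso_def isomorphic_def)
  then have "orthogonal T (S X) (S (D Y))"
    using orth by (rule orthogonal_isomorphic_right)
  then have "Susp_arr T f = Zero T (S X) (S (D Y))"
    using Susp_arr_closed[OF f] by (rule orthogonalD)
  also have "\<dots> = Susp_arr T (Zero T X (D Y))"
    using Susp_arr_Zero Hom_obj[OF f] by simp
  finally show "f \<in> {Zero T X (D Y)}"
    using Susp_arr_inject[OF f] Zero_closed Hom_obj[OF f] by blast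
qed

section \<open>Exact triangles, vanishing of Hom, and homotopy (co)limits\<close>

lemma exact_Hom:
  assumes "(f, g, h) \<in> Exact T"
  shows "f \<in> Hom T (Dom T f) (Cod T f)" "g \<in> Hom T (Cod T f) (Cod T g)"
    "h \<in> Hom T (Cod T g) (S (Dom T f))"
  using exact_triangle[OF assms] by (auto simp: is_triangle_def Hom_def)

lemma is_triangleI:
  assumes "f \<in> Hom T X Y" "g \<in> Hom T Y Z" "h \<in> Hom T Z (S X)"
  shows "is_triangle T f g h"
  using assms by (auto simp: is_triangle_def Hom_def)

lemma exact_rotate:
  assumes "(f, g, h) \<in> Exact T"
  shows "(g, h, Neg T (Susp_arr T f)) \<in> Exact T"
  using assms TR2[OF exact_triangle[OF assms]] by blast

text \<open>The identity triangle of \<open>X\<close> rotated backwards. It is formed with the zero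
  object \<open>S Z\<close>, so that the new first morphism starts at \<open>Z\<close>.\<close>

lemma exact_Zero_Ident:
  assumes X: "X \<in> Obj T" and Z: "zero_object T Z"
  shows "(Zero T Z X, Ident T X, Zero T X (S Z)) \<in> Exact T"
proof -
  have objs: "Z \<in> Obj T" "S Z \<in> Obj T" "S X \<in> Obj T"
    using zero_object_Obj[OF Z] X Susp_obj_closed by auto
  have "Neg T (Susp_arr T (Zero T Z X)) = Zero T (S Z) (S X)"
    using Susp_arr_Zero Neg_eq_Zero_iff Zero_closed X objs by simp
  moreover have "is_triangle T (Zero T Z X) (Ident T X) (Zero T X (S Z))"
    using is_triangleI Zero_closed ident_closed X objs by blast
  ultimately show ?thesis
    using TR2 TR1_ident[OF X zero_object_Susp[OF Z]] by simp
qed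

text \<open>Exactness of Hom(-, \<open>Y\<close>): a morphism that vanishes after composition with
  \<open>f\<close> factors through \<open>g\<close>.\<close>

lemma orthogonal_exact_middle:
  assumes ex: "(f, g, h) \<in> Exact T"
    and orth: "orthogonal T (Dom T f) Y" "orthogonal T (Cod T g) Y"
  shows "orthogonal T (Cod T f) Y"
  unfolding orthogonal_def
proof
  fix u assume u: "u \<in> Hom T (Cod T f) Y"
  obtain Z where Z: "zero_object T Z"
    using ex_zero_object by blast
  let ?X = "Dom T f"
  note fg = exact_Hom[OF ex]
  have objs: "?X \<in> Obj T" "Cod T f \<in> Obj T" "Y \<in> Obj T" "Z \<in> Obj T"
    using Hom_obj[OF fg(1)] Hom_obj[OF u] zero_object_Obj[OF Z] by auto
  have z: "Zero T ?X Z \<in> Hom T ?X Z" "Zero T Z Y \<in> Hom T Z Y" "Ident T Y \<in> Hom T Y Y"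
    using Zero_closed ident_closed objs by auto
  have "u \<cdot> f = Zero T Z Y \<cdot> Zero T ?X Z"
    using orthogonalD[OF orth(1) comp_closed[OF fg(1) u]] comp_Zero_left[OF z(1)] objs by simp
  moreover have "Dom T (Zero T Z Y) = Z" "Cod T (Zero T Z Y) = Y" "Cod T (Ident T Y) = Y"
    using z by (auto simp: Hom_def)
  \<comment> \<open>TR3 maps the given triangle to the one with terms \<open>Z\<close>,
    \<open>Y\<close>, \<open>Y\<close>; its third component extends \<open>u\<close> along
    \<open>g\<close>.\<close>
  ultimately obtain w where w: "w \<in> Hom T (Cod T g) Y" "w \<cdot> g = Ident T Y \<cdot> u"
    using TR3[OF ex exact_Zero_Ident[OF objs(3) Z]] z(1) u by metis
  then have "u = Zero T (Cod T g) Y \<cdot> g"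
    using ident_left[OF u] orthogonalD[OF orth(2) w(1)] by simp
  then show "u \<in> {Zero T (Cod T f) Y}"
    using comp_Zero_left[OF fg(2)] objs by simp
qed

text \<open>Exactness of Hom(\<open>X\<close>, -) one place earlier: if \<open>f\<close> kills
  \<open>u\<close>, the suspension of \<open>u\<close> factors up to sign through \<open>h\<close>.
  Working with \<open>S X\<close> on the left avoids desuspending the third object of the
  triangle.\<close>

lemma orthogonal_exact_first:
  assumes ex: "(f, g, h) \<in> Exact T"
    and orth: "orthogonal T X (Cod T f)" "orthogonal T (S X) (Cod T g)"
  shows "orthogonal T X (Dom T f)"
  unfolding orthogonal_def
proof
  fix u assume u: "u \<in> Hom T X (Dom T f)"
  obtain Z where Z: "zero_object T Z"
    using ex_zero_object by blast
  note fg = exact_Hom[OF ex]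
  have objs: "X \<in> Obj T" "Dom T f \<in> Obj T" "Cod T f \<in> Obj T" "Z \<in> Obj T" "S X \<in> Obj T"
    using Hom_obj[OF fg(1)] Hom_obj[OF u] zero_object_Obj[OF Z] Susp_obj_closed by auto
  have z: "Zero T X Z \<in> Hom T X Z" "Zero T Z (Cod T f) \<in> Hom T Z (Cod T f)"
    "Zero T Z (S X) \<in> Hom T Z (S X)"
    using Zero_closed objs by auto
  let ?i = "Neg T (Ident T (S X))"
  have i: "?i \<in> Hom T (S X) (S X)"
    using Neg_closed ident_closed objs by blast
  \<comment> \<open>The rotated identity triangle with terms \<open>X\<close>, \<open>Z\<close>,
    \<open>S X\<close>; rotation turns its last morphism into minus the identity.\<close>
  have tri: "(Zero T X Z, Zero T Z (S X), ?i) \<in> Exact T"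
    using exact_rotate[OF TR1_ident[OF objs(1) Z]] Susp_arr_Ident[OF objs(1)] by simp
  have comm: "Zero T Z (Cod T f) \<cdot> Zero T X Z = f \<cdot> u"
    using orthogonalD[OF orth(1) comp_closed[OF u fg(1)]] comp_Zero_left[OF z(1)] objs by simp
  have "Dom T (Zero T X Z) = X" "Cod T (Zero T X Z) = Z" "Cod T (Zero T Z (S X)) = S X"
    using z by (auto simp: Hom_def)
  then obtain w where w: "w \<in> Hom T (S X) (Cod T g)" "Susp_arr T u \<cdot> ?i = h \<cdot> w"
    using TR3[OF tri ex _ _ comm] z u by auto
  have Su: "Susp_arr T u \<in> Hom T (S X) (S (Dom T f))"
    using Susp_arr_closed[OF u] .
  have "Neg T (Susp_arr T u) = Susp_arr T u \<cdot> ?i"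
    using comp_Neg_right[OF ident_closed[OF objs(5)] Su] ident_right[OF Su] by simp
  also have "\<dots> = Zero T (S X) (S (Dom T f))"
    using w orthogonalD[OF orth(2) w(1)] comp_Zero_right[OF exact_Hom(3)[OF ex]] objs by simp
  finally have "Susp_arr T u = Susp_arr T (Zero T X (Dom T f))"
    using Neg_eq_Zero_iff[OF Su] Susp_arr_Zero objs by simp
  then show "u \<in> {Zero T X (Dom T f)}"
    using Susp_arr_inject[OF u] Zero_closed objs by blast
qed

text \<open>In the rotated triangle \<open>H\<close> lies between \<open>P\<close> and
  \<open>S P\<close>. Asking for vanishing into \<open>D Y\<close>, instead of out of the suspended
  terms, avoids comparing the suspension of the coproduct with a coproduct of suspensions.\<close>

lemma orthogonal_hocolim:
  assumes H: "is_hocolim T X \<phi> H \<gamma>"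
    and orth: "\<And>n. orthogonal T (X n) Y" "\<And>n. orthogonal T (X n) (D Y)"
  shows "orthogonal T H Y"
proof -
  from H obtain P inc d c e where P: "is_coproduct T UNIV X P inc"
    and d: "d \<in> Hom T P P" and c: "c \<in> Hom T P H" and ex: "(d, c, e) \<in> Exact T"
    unfolding is_hocolim_def by blast
  have "orthogonal T P Y" "orthogonal T P (D Y)"
    using orthogonal_coproduct[OF P] orth by blast+
  then have "orthogonal T P Y" "orthogonal T (S P) Y"
    using orthogonal_Susp_if Hom_obj[OF d] by auto
  then show ?thesis
    using orthogonal_exact_middle[OF exact_rotate[OF ex]] c d exact_Hom[OF ex]
    by (simp add: Hom_def)
qed

text \<open>Here \<open>H\<close> is the first term of the defining triangle, so vanishing into the
  product is needed from both \<open>X\<close> and \<open>S X\<close>.\<close>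

lemma orthogonal_holim:
  assumes H: "is_holim T Y \<psi> H \<sigma>"
    and orth: "\<And>n. orthogonal T X (Y n)" "\<And>n. orthogonal T (S X) (Y n)"
  shows "orthogonal T X H"
proof -
  from H obtain P pr d s e where P: "is_product T UNIV Y P pr"
    and d: "d \<in> Hom T P P" and s: "s \<in> Hom T H P" and ex: "(s, d, e) \<in> Exact T"
    unfolding is_holim_def by blast
  have "orthogonal T X P" "orthogonal T (S X) P"
    using orthogonal_product[OF P] orth by blast+
  then show ?thesis
    using orthogonal_exact_first[OF ex] s d by (simp add: Hom_def)
qed

section \<open>Towers\<close>

lemma isomorphic_Desusp: "isomorphic T X Y \<Longrightarrow> isomorphic T (D X) (D Y)"
  using isomorphic_endofunctor desusp_functor by blast

lemma Susp_pow_nonneg: "Susp_pow T (int n) = S ^^ n"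
  by (simp add: Susp_pow_def)

lemma Susp_pow_nonpos: "Susp_pow T (- int n) = D ^^ n"
  by (simp add: Susp_pow_def)

lemma Desusp_Susp_image:
  assumes "Z \<in> Susp_image T (- int n) \<U>"
  shows "D Z \<in> Susp_image T (- int (Suc n)) \<U>"
proof -
  from assms obtain X where "Z \<in> Obj T" "X \<in> \<U>" "isomorphic T Z ((D ^^ n) X)"
    unfolding Susp_image_def Susp_pow_nonpos by blast
  then have "D Z \<in> Obj T" "X \<in> \<U>" "isomorphic T (D Z) ((D ^^ Suc n) X)"
    using isomorphic_Desusp Desusp_obj_closed by auto
  then show ?thesis
    unfolding Susp_image_def Susp_pow_nonpos by blast
qed

text \<open>Closure under isomorphism is not part of being a full additive subcategory. It follows
  from closure under extensions: \<open>Z\<close> is an extension of a zero object by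
  \<open>X\<close>.\<close>

lemma extension_closed_isomorphic:
  assumes \<U>: "full_additive_subcategory T \<U>" "extensions T \<U> \<U> \<subseteq> \<U>"
    and X: "X \<in> \<U>" and iso: "isomorphic T Z X"
  shows "Z \<in> \<U>"
proof -
  from \<U>(1) obtain O' where O': "O' \<in> \<U>" "zero_object T O'"
    by (auto simp: full_additive_subcategory_def)
  obtain e where e: "is_iso T X Z e"
    using isomorphic_sym[OF iso] by (auto simp: isomorphic_def)
  then have e_Hom: "e \<in> Hom T X Z"
    by (simp add: is_iso_def)
  have objs: "X \<in> Obj T" "Z \<in> Obj T" "O' \<in> Obj T" "S X \<in> Obj T"
    using Hom_obj[OF e_Hom] zero_object_Obj[OF O'(2)] Susp_obj_closed by auto
  have z: "Zero T X O' \<in> Hom T X O'" "Zero T Z O' \<in> Hom T Z O'"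
    "Zero T O' (S X) \<in> Hom T O' (S X)" "Ident T X \<in> Hom T X X" "Ident T O' \<in> Hom T O' O'"
    using Zero_closed ident_closed objs by auto
  have "Dom T (Ident T X) = X" "Cod T (Ident T X) = X" "Cod T (Zero T X O') = O'"
    "Dom T e = X" "Cod T e = Z" "Cod T (Zero T Z O') = O'"
    using z e_Hom by (auto simp: Hom_def)
  moreover have "Ident T O' \<cdot> Zero T X O' = Zero T Z O' \<cdot> e"
    using ident_left[OF z(1)] comp_Zero_left[OF e_Hom objs(3)] by simp
  moreover have "Susp_arr T (Ident T X) \<cdot> Zero T O' (S X) = Zero T O' (S X) \<cdot> Ident T O'"
    using Susp_arr_Ident[OF objs(1)] ident_left[OF z(3)] ident_right[OF z(3)] by simp
  \<comment> \<open>The identity triangle of \<open>X\<close> is transported along the identity of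
    \<open>X\<close>, \<open>e\<close>, and the identity of \<open>O'\<close>.\<close>
  ultimately have "(e, Zero T Z O', Zero T O' (S X)) \<in> Exact T"
    using exact_iso[OF TR1_ident[OF objs(1) O'(2)] is_triangleI[OF e_Hom z(2,3)],
        of "Ident T X" e "Ident T O'"] is_iso_Ident e objs by simp
  then have "Z \<in> extensions T \<U> \<U>"
    using objs X O'(1) e_Hom z(2) unfolding extensions_def by blast
  then show ?thesis
    using \<U>(2) by blast
qed

lemma U_interval_0_0:
  assumes "pre_weight_structure T Uge Ule"
  shows "U_interval T Uge Ule 0 0 \<subseteq> core Uge Ule"
proof
  fix Z assume "Z \<in> U_interval T Uge Ule 0 0"
  then obtain X Y where "X \<in> Uge" "isomorphic T Z X" "Y \<in> Ule" "isomorphic T Z Y"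
    by (auto simp: U_interval_def U_ge_def U_le_def Susp_image_def Susp_pow_def)
  then have "Z \<in> Uge" "Z \<in> Ule"
    using assms unfolding pre_weight_structure_def
    by (metis extension_closed_isomorphic)+
  then show "Z \<in> core Uge Ule"
    by (simp add: core_def)
qed

text \<open>\<open>Ys (n + 1)\<close> is the first term of the triangle on \<open>\<psi> n\<close>,
  so its cone is tested against \<open>S X\<close>. The hypotheses include exponent 0, which occurs
  both at \<open>Ys 0\<close> and as the cone of \<open>\<psi> 0\<close>.\<close>

lemma right_tower_orthogonal:
  assumes tower: "right_tower T Uge Ule Y Ys \<pi> \<psi>" and pw: "pre_weight_structure T Uge Ule"
    and orth: "\<And>n Z. Z \<in> Susp_image T (- int n) (core Uge Ule) \<Longrightarrow> orthogonal T X Z"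
      "\<And>n Z. Z \<in> Susp_image T (- int n) (core Uge Ule) \<Longrightarrow> orthogonal T (S X) Z"
  shows "orthogonal T X (Ys n)"
proof (induction n)
  case 0
  have "Ys 0 \<in> U_interval T Uge Ule 0 (int 0)"
    using tower unfolding right_tower_def by blast
  then have "Ys 0 \<in> core Uge Ule" "Ys 0 \<in> Obj T"
    using U_interval_0_0[OF pw] by (auto simp: U_interval_def U_ge_def Susp_image_def)
  then have "Ys 0 \<in> Susp_image T (- int 0) (core Uge Ule)"
    using isomorphic_refl by (auto simp: Susp_image_def Susp_pow_def)
  then show ?case
    by (rule orth(1))
next
  case (Suc n)
  from tower have \<psi>: "\<psi> n \<in> Hom T (Ys (n + 1)) (Ys n)"
    and "cone_in T (\<psi> n) (Susp_image T (- int n) (core Uge Ule))"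
    by (auto simp: right_tower_def)
  then obtain g h where "(\<psi> n, g, h) \<in> Exact T" "orthogonal T (S X) (Cod T g)"
    using orth(2) by (auto simp: cone_in_def)
  then show ?case
    using orthogonal_exact_first[of "\<psi> n" g h X] Suc \<psi> by (simp add: Hom_def)
qed

text \<open>The homotopy limit costs one suspension of \<open>X\<close> and the induction along the
  tower another, hence the three conditions.\<close>

lemma right_convergent_orthogonal:
  assumes conv: "right_convergent T Uge Ule" and pw: "pre_weight_structure T Uge Ule"
    and Y: "Y \<in> Uge"
    and orth: "\<And>n Z. Z \<in> Susp_image T (- int n) (core Uge Ule) \<Longrightarrow> orthogonal T X Z"
      "\<And>n Z. Z \<in> Susp_image T (- int n) (core Uge Ule) \<Longrightarrow> orthogonal T (S X) Z"
      "\<And>n Z. Z \<in> Susp_image T (- int n) (core Uge Ule) \<Longrightarrow> orthogonal T (S (S X)) Z"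
  shows "orthogonal T X Y"
proof -
  from conv Y obtain Ys \<pi> \<psi> H \<sigma> \<theta> where tower: "right_tower T Uge Ule Y Ys \<pi> \<psi>"
    and H: "is_holim T Ys \<psi> H \<sigma>" and iso: "is_iso T Y H \<theta>"
    unfolding right_convergent_def convergent_right_tower_def by metis
  have "orthogonal T X (Ys n)" "orthogonal T (S X) (Ys n)" for n
    using right_tower_orthogonal[OF tower pw] orth by blast+
  then have "orthogonal T X H"
    using orthogonal_holim[OF H] by blast
  then show ?thesis
    using iso orthogonal_isomorphic_right by (auto simp: isomorphic_def)
qed

text \<open>\<open>Xs (n + 1)\<close> is the middle term of the triangle on \<open>\<phi> n\<close>,
  so \<open>Y\<close> is never shifted along the induction.\<close>

lemma left_tower_orthogonal:
  assumes tower: "left_tower T Uge Ule X Xs \<iota> \<phi>" and pw: "pre_weight_structure T Uge Ule"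
    and orth: "\<And>n Z. Z \<in> Susp_image T (int n) (core Uge Ule) \<Longrightarrow> orthogonal T Z Y"
  shows "orthogonal T (Xs n) Y"
proof (induction n)
  case 0
  have "Xs 0 \<in> U_interval T Uge Ule (- int 0) 0"
    using tower unfolding left_tower_def by blast
  then have "Xs 0 \<in> core Uge Ule" "Xs 0 \<in> Obj T"
    using U_interval_0_0[OF pw] by (auto simp: U_interval_def U_ge_def Susp_image_def)
  then have "Xs 0 \<in> Susp_image T (int 0) (core Uge Ule)"
    using isomorphic_refl by (auto simp: Susp_image_def Susp_pow_def)
  then show ?case
    by (rule orth)
next
  case (Suc n)
  from tower have \<phi>: "\<phi> n \<in> Hom T (Xs n) (Xs (n + 1))"
    and "cone_in T (\<phi> n) (Susp_image T (int (Suc n)) (core Uge Ule))"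
    by (auto simp: left_tower_def add.commute)
  then obtain g h where "(\<phi> n, g, h) \<in> Exact T" "orthogonal T (Cod T g) Y"
    using orth unfolding cone_in_def by blast
  then show ?case
    using orthogonal_exact_middle[of "\<phi> n" g h Y] Suc \<phi> by (simp add: Hom_def)
qed

lemma left_convergent_orthogonal:
  assumes conv: "left_convergent T Uge Ule" and pw: "pre_weight_structure T Uge Ule"
    and X: "X \<in> Ule"
    and orth: "\<And>n Z. Z \<in> Susp_image T (int n) (core Uge Ule) \<Longrightarrow> orthogonal T Z Y"
      "\<And>n Z. Z \<in> Susp_image T (int n) (core Uge Ule) \<Longrightarrow> orthogonal T Z (D Y)"
  shows "orthogonal T X Y"
proof -
  from conv X obtain Xs \<iota> \<phi> H \<gamma> \<kappa> where tower: "left_tower T Uge Ule X Xs \<iota> \<phi>"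
    and H: "is_hocolim T Xs \<phi> H \<gamma>" and iso: "is_iso T H X \<kappa>"
    unfolding left_convergent_def convergent_left_tower_def by metis
  have "orthogonal T (Xs n) Y" "orthogonal T (Xs n) (D Y)" for n
    using left_tower_orthogonal[OF tower pw] orth by blast+
  then have "orthogonal T H Y"
    using orthogonal_hocolim[OF H] by blast
  moreover have "isomorphic T X H"
    using iso isomorphic_sym by (auto simp: isomorphic_def)
  ultimately show ?thesis
    using orthogonal_isomorphic_left by blast
qed

section \<open>From the core to \<open>U_ge T Uge 1\<close>\<close>

lemma U_ge_1E:
  assumes "B \<in> U_ge T Uge 1"
  obtains Y where "B \<in> Obj T" "Y \<in> Uge" "isomorphic T B (D Y)"
  using assms by (auto simp: U_ge_def Susp_image_def Susp_pow_def)

lemma Desusp_U_ge_1: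
  assumes "B \<in> U_ge T Uge 1" "D ` Uge \<subseteq> Uge"
  shows "D B \<in> U_ge T Uge 1"
proof -
  from assms(1) obtain Y where "B \<in> Obj T" "Y \<in> Uge" "isomorphic T B (D Y)"
    by (rule U_ge_1E)
  then have "D B \<in> Obj T" "D Y \<in> Uge" "isomorphic T (D B) (D (D Y))"
    using isomorphic_Desusp Desusp_obj_closed assms(2) by auto
  then show ?thesis
    by (auto simp: U_ge_def Susp_image_def Susp_pow_def)
qed

text \<open>Writing \<open>B\<close> as \<open>D Y\<close> up to isomorphism trades
  Hom(\<open>c\<close>, \<open>B\<close>) for Hom(\<open>S c\<close>, \<open>Y\<close>), and a right
  tower of \<open>Y\<close> applies. The extra suspension is what makes exponent 0 in the tower
  harmless.\<close>

lemma orthogonal_core_U_ge_1: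
  assumes conv: "right_convergent T Uge Ule" and pw: "pre_weight_structure T Uge Ule"
    and vanish: "\<And>n::nat. n \<ge> 1 \<Longrightarrow>
      Hom_vanish T (core Uge Ule) (Susp_image T (- int n) (core Uge Ule))"
    and c: "c \<in> core Uge Ule" and B: "B \<in> U_ge T Uge 1"
  shows "orthogonal T c B"
proof -
  have objs: "c \<in> Obj T" "S c \<in> Obj T" "S (S c) \<in> Obj T"
    using pw c Susp_obj_closed
    by (auto simp: pre_weight_structure_def full_additive_subcategory_def core_def)
  have base: "orthogonal T c Z" if "Z \<in> Susp_image T (- int (Suc n)) (core Uge Ule)" for Z n
    using vanish[of "Suc n"] c that by (auto simp: Hom_vanish_def orthogonal_def)
  \<comment> \<open>Moving \<open>S\<close> across Hom raises the exponent from \<open>n\<close> to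
    \<open>Suc n\<close>, so the vanishing assumption, which starts at 1, now covers
    \<open>n = 0\<close>.\<close>
  have 1: "orthogonal T (S c) Z" if "Z \<in> Susp_image T (- int n) (core Uge Ule)" for Z n
    using orthogonal_Susp_if[OF base[OF Desusp_Susp_image[OF that]]] objs by blast
  have 2: "orthogonal T (S (S c)) Z" if "Z \<in> Susp_image T (- int n) (core Uge Ule)" for Z n
    using orthogonal_Susp_if[OF 1[OF Desusp_Susp_image[OF that]]] objs by blast
  have 3: "orthogonal T (S (S (S c))) Z" if "Z \<in> Susp_image T (- int n) (core Uge Ule)" for Z n
    using orthogonal_Susp_if[OF 2[OF Desusp_Susp_image[OF that]]] objs by blast
  obtain Y where Y: "Y \<in> Uge" "isomorphic T B (D Y)"
    using B by (rule U_ge_1E)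
  have "orthogonal T (S c) Y"
    using right_convergent_orthogonal[OF conv pw Y(1)] 1 2 3 by blast
  moreover have "Y \<in> Obj T"
    using pw Y(1) by (auto simp: pre_weight_structure_def full_additive_subcategory_def)
  ultimately show ?thesis
    using orthogonal_Desusp_if orthogonal_isomorphic_right Y(2) by blast
qed

text \<open>Each suspension on the left is moved to a desuspension on the right, which stays in
  \<open>\<V>\<close>; hence the induction must keep \<open>B\<close> arbitrary.\<close>

lemma orthogonal_Susp_image:
  assumes orth: "\<And>c B. \<lbrakk>c \<in> \<U>; B \<in> \<V>\<rbrakk> \<Longrightarrow> orthogonal T c B"
    and \<U>: "\<U> \<subseteq> Obj T" and \<V>: "D ` \<V> \<subseteq> \<V>"
    and Z: "Z \<in> Susp_image T (int n) \<U>" and B: "B \<in> \<V>"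
  shows "orthogonal T Z B"
proof -
  from Z obtain c where c: "c \<in> \<U>" "isomorphic T Z ((S ^^ n) c)"
    unfolding Susp_image_def Susp_pow_nonneg by blast
  have pow_closed: "(S ^^ n) c \<in> Obj T" for n
    using c(1) \<U> Susp_obj_closed by (induction n) auto
  have "orthogonal T ((S ^^ n) c) B"
    using B
  proof (induction n arbitrary: B)
    case 0
    then show ?case using orth c(1) by simp
  next
    case (Suc n)
    then have "orthogonal T ((S ^^ n) c) (D B)"
      using \<V> by blast
    then show ?case
      using orthogonal_Susp_if[OF _ pow_closed] by simp
  qed
  then show ?thesis
    using orthogonal_isomorphic_left c(2) by blast
qed

end

theorem proposition3p5:
  fixes T :: "('o, 'm, 'x) triangulated_category_scheme"
    and Uge Ule :: "'o set"
    and small :: "'i set \<Rightarrow> bool"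
  assumes "triangulated_category T"
    and "pre_weight_structure T Uge Ule"
    and "smallness small"
    and "bicomplete small T"
    and "two_sided_convergent T Uge Ule"
    and "\<And>n::nat. n \<ge> 1 \<Longrightarrow>
      Hom_vanish T (core Uge Ule) (Susp_image T (- int n) (core Uge Ule))"
  shows "Hom_vanish T Ule (U_ge T Uge 1)"
proof -
  interpret triangulated_category T by fact
  note pw = assms(2)
  have left: "left_convergent T Uge Ule" and right: "right_convergent T Uge Ule"
    using assms(5) by (auto simp: two_sided_convergent_def)
  have sub: "core Uge Ule \<subseteq> Obj T" "Ule \<subseteq> Obj T" "D ` Uge \<subseteq> Uge"
    using pw by (auto simp: pre_weight_structure_def full_additive_subcategory_def core_def)
  have D_closed: "D ` U_ge T Uge 1 \<subseteq> U_ge T Uge 1"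
    using Desusp_U_ge_1 sub(3) by blast
  have core_orth: "orthogonal T Z B"
    if "Z \<in> Susp_image T (int n) (core Uge Ule)" "B \<in> U_ge T Uge 1" for n Z B
    using orthogonal_Susp_image[OF orthogonal_core_U_ge_1[OF right pw assms(6)] sub(1) D_closed that]
    by blast
  have "Hom T X B = {Zero T X B}" if X: "X \<in> Ule" and B: "B \<in> U_ge T Uge 1" for X B
  proof -
    \<comment> \<open>The left tower argument needs vanishing into both \<open>B\<close> and
      \<open>D B\<close>; \<open>D_closed\<close> reduces the second to \<open>core_orth\<close> as
      well.\<close>
    have "orthogonal T X B"
      using left_convergent_orthogonal[OF left pw X] core_orth B D_closed by blast
    moreover have "X \<in> Obj T" "B \<in> Obj T"
      using X sub(2) B by (auto simp: U_ge_def Susp_image_def)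
    ultimately show ?thesis
      using Zero_closed unfolding orthogonal_def by blast
  qed
  then show ?thesis
    by (simp add: Hom_vanish_def)
qed

end
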